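(* Let $G=(V,E)$ be a graph with edge weights $w\in\mathbb{R}^E_{\ge 0}$, let $f$ be its graph coverage function, and let $\mathcal{M}$ be a matroid on $V$ of rank $k\ge 1$. Let $\mathcal{P}$ be the partition returned by the Gomory-Hu tree algorithm run on the cut function $d_w$ and $\mathcal{M}$ (described in the context). Then $\mathcal{P}$ is feasible and $f(\mathcal{P})\le \tfrac{4}{3}\,\mathrm{OPT}$, where $\mathrm{OPT}$ is the minimum of $f(\mathcal{P}')$ over all feasible partitions $\mathcal{P}'$.
   Context: The graph coverage function is $f(S)=\sum_{uv\in E:\{u,v\}\cap S\ne\emptyset} w(uv)$ for $S\subseteq V$; the cut function is $d_w(S)=\sum_{uv\in E: |\{u,v\}\cap S|=1} w(uv)$ (symmetric and submodular). For a partition $\mathcal{P}$, $f(\mathcal{P})=\sum_{X\in\mathcal{P}}f(X)$. A partition $\{V_1,\dots,V_k\}$ of $V$ is feasible if some basis $B$ of $\mathcal{M}$ has $|B\cap V_i|=1$ for all $i$. A Gomory-Hu tree of a symmetric submodular $g$ on $V$ is a tree $H=(V,F)$ with weights $w_H\ge 0$ such that for all distinct $s,t$, the minimum $w_H$-weight on the $s$–$t$ path in $H$ equals $\min\{g(S): s\in S\subseteq V\setminus\{t\}\}$, and the two components of $H$ minus a minimum-weight edge of that path form a minimizer. For a tree $H=(V,F)$ and $\mathcal{M}=(V,\mathcal{I})$, let $\mathcal{I}'$ be the family of $X'\subseteq F$ such that the components $V_1,\dots,V_{|X'|+1}$ of $H-X'$ admit $v_i\in V_i$ with $\{v_1,\dots,v_{|X'|+1}\}\in\mathcal{I}$.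 Gomory-Hu tree algorithm on $(g,\mathcal{M})$: compute a Gomory-Hu tree $(H,w_H)$ of $g$; start with $C=\emptyset$; while $|C|<k-1$, add to $C$ an edge $e\notin C$ with $C\cup\{e\}\in\mathcal{I}'$ of minimum $w_H(e)$; return the components of $(V,F\setminus C)$. *)

theory Defs
  imports Complex_Main "HOL-Library.Disjoint_Sets"
begin

locale matroid =
  fixes V :: "'a set" and \<I> :: "'a set set"
  assumes finite_ground: "finite V"
    and indep_subset: "X \<in> \<I> \<Longrightarrow> X \<subseteq> V"
    and empty_indep: "{} \<in> \<I>"
    and indep_hereditary: "X \<in> \<I> \<Longrightarrow> Y \<subseteq> X \<Longrightarrow> Y \<in> \<I>"
    and indep_augment: "X \<in> \<I> \<Longrightarrow> Y \<in> \<I> \<Longrightarrow> card X < card Y \<Longrightarrow> \<exists>y\<in>Y - X. insert y X \<in> \<I>"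

definition basis :: "'a set set \<Rightarrow> 'a set \<Rightarrow> bool" where
  "basis \<I> B \<longleftrightarrow> B \<in> \<I> \<and> (\<forall>X\<in>\<I>. B \<subseteq> X \<longrightarrow> X = B)"

definition matroid_rank :: "'a set set \<Rightarrow> nat" where
  "matroid_rank \<I> = Max (card ` \<I>)"

text \<open>Graphs are finite, simple and undirected; an edge \<open>uv\<close> is the set \<open>{u, v}\<close>.\<close>

definition graph :: "'a set \<Rightarrow> 'a set set \<Rightarrow> bool" where
  "graph V E \<longleftrightarrow> finite V \<and> (\<forall>e\<in>E. e \<subseteq> V \<and> card e = 2)"

definition component :: "'a set \<Rightarrow> 'a set set \<Rightarrow> 'a \<Rightarrow> 'a set" where
  "component V E u = {v \<in> V. (u, v) \<in> {(x, y). {x, y} \<in> E}\<^sup>*}"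

definition components :: "'a set \<Rightarrow> 'a set set \<Rightarrow> 'a set set" where
  "components V E = component V E ` V"

fun path_edges :: "'a list \<Rightarrow> 'a set set" where
  "path_edges (x # y # xs) = insert {x, y} (path_edges (y # xs))"
| "path_edges _ = {}"

definition is_path :: "'a set \<Rightarrow> 'a set set \<Rightarrow> 'a \<Rightarrow> 'a list \<Rightarrow> 'a \<Rightarrow> bool" where
  "is_path V E s p t \<longleftrightarrow>
     p \<noteq> [] \<and> hd p = s \<and> last p = t \<and> distinct p \<and> set p \<subseteq> V \<and> path_edges p \<subseteq> E"

text \<open>A cycle is a path on at least three vertices whose end vertices are adjacent.\<close>

definition tree :: "'a set \<Rightarrow> 'a set set \<Rightarrow> bool" where
  "tree V F \<longleftrightarrow> graph V F \<and> V \<noteq> {} \<and>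
     (\<forall>s\<in>V. \<forall>t\<in>V. \<exists>p. is_path V F s p t) \<and>
     \<not> (\<exists>s p t. is_path V F s p t \<and> length p \<ge> 3 \<and> {t, s} \<in> F)"

definition coverage :: "'a set set \<Rightarrow> ('a set \<Rightarrow> real) \<Rightarrow> 'a set \<Rightarrow> real" where
  "coverage E w S = (\<Sum>e | e \<in> E \<and> e \<inter> S \<noteq> {}. w e)"

definition cut_fun :: "'a set set \<Rightarrow> ('a set \<Rightarrow> real) \<Rightarrow> 'a set \<Rightarrow> real" where
  "cut_fun E w S = (\<Sum>e | e \<in> E \<and> card (e \<inter> S) = 1. w e)"

definition partition_cost :: "('a set \<Rightarrow> real) \<Rightarrow> 'a set set \<Rightarrow> real" where
  "partition_cost f P = (\<Sum>X\<in>P. f X)"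

definition feasible :: "'a set \<Rightarrow> 'a set set \<Rightarrow> 'a set set \<Rightarrow> bool" where
  "feasible V \<I> P \<longleftrightarrow> partition_on V P \<and> card P = matroid_rank \<I> \<and>
     (\<exists>B. basis \<I> B \<and> (\<forall>X\<in>P. card (B \<inter> X) = 1))"

definition opt :: "'a set \<Rightarrow> 'a set set \<Rightarrow> ('a set \<Rightarrow> real) \<Rightarrow> real" where
  "opt V \<I> f = Min (partition_cost f ` {P. feasible V \<I> P})"

text \<open>In a tree the path \<open>p\<close> below is unique. Deleting an edge of it leaves two components,
  of which the one containing \<open>s\<close> is the candidate minimizer.\<close>

definition gomory_hu_tree ::
  "'a set \<Rightarrow> ('a set \<Rightarrow> real) \<Rightarrow> 'a set set \<Rightarrow> ('a set \<Rightarrow> real) \<Rightarrow> bool" where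
  "gomory_hu_tree V g F w\<^sub>H \<longleftrightarrow> tree V F \<and> (\<forall>e\<in>F. w\<^sub>H e \<ge> 0) \<and>
     (\<forall>s\<in>V. \<forall>t\<in>V. \<forall>p. s \<noteq> t \<longrightarrow> is_path V F s p t \<longrightarrow>
        Min (w\<^sub>H ` path_edges p) = Min (g ` {S. s \<in> S \<and> S \<subseteq> V - {t}}) \<and>
        (\<forall>e. is_arg_min w\<^sub>H (\<lambda>e. e \<in> path_edges p) e \<longrightarrow>
           is_arg_min g (\<lambda>S. s \<in> S \<and> S \<subseteq> V - {t}) (component V (F - {e}) s)))"

text \<open>The family \<open>\<I>'\<close>; the function \<open>v\<close> chooses one vertex in each component.\<close>

definition tree_indep :: "'a set \<Rightarrow> 'a set set \<Rightarrow> 'a set set \<Rightarrow> 'a set set set" where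
  "tree_indep V \<I> F = {X. X \<subseteq> F \<and>
     (\<exists>v. (\<forall>K\<in>components V (F - X). v K \<in> K) \<and> v ` components V (F - X) \<in> \<I>)}"

text \<open>One iteration of the while loop, with ties broken arbitrarily.\<close>

definition gh_step ::
  "'a set \<Rightarrow> 'a set set \<Rightarrow> 'a set set \<Rightarrow> ('a set \<Rightarrow> real) \<Rightarrow> 'a set set \<Rightarrow> 'a set set \<Rightarrow> bool" where
  "gh_step V \<I> F w\<^sub>H C C' \<longleftrightarrow> card C < matroid_rank \<I> - 1 \<and>
     (\<exists>e. is_arg_min w\<^sub>H (\<lambda>e. e \<in> F - C \<and> insert e C \<in> tree_indep V \<I> F) e \<and> C' = insert e C)"

text \<open>The possible results of the algorithm. A run ends when no further iteration is possible,
  so a hypothetical run that found no edge to add while \<open>|C| < k - 1\<close> is included as well, and a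
  statement about all results also covers the claim that this never happens.\<close>

definition gh_algorithm_returns ::
  "'a set \<Rightarrow> ('a set \<Rightarrow> real) \<Rightarrow> 'a set set \<Rightarrow> 'a set set \<Rightarrow> bool" where
  "gh_algorithm_returns V g \<I> P \<longleftrightarrow>
     (\<exists>F w\<^sub>H C. gomory_hu_tree V g F w\<^sub>H \<and> (gh_step V \<I> F w\<^sub>H)\<^sup>*\<^sup>* {} C \<and>
        \<not> (\<exists>C'. gh_step V \<I> F w\<^sub>H C C') \<and> P = components V (F - C))"

end

theory Submission
  imports Defs
begin

text \<open>Write \<open>W\<close> for the total weight and \<open>cr(\<P>)\<close> for the weight of the edges running between
  parts of \<open>\<P>\<close>, so that \<open>f(\<P>) = W + cr(\<P>)\<close> and \<open>d\<^sub>w(\<P>) = 2 cr(\<P>)\<close>. The family \<open>\<I>'\<close> is a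
  matroid, hence the greedy choice \<open>C\<close> has minimum tree weight among its bases. Given a feasible
  partition \<open>\<Q>\<close> with transversal basis \<open>B\<close>, let \<open>Y\<close> be a cheapest set of tree edges whose deletion
  leaves one element of \<open>B\<close> in each component; it is a basis of \<open>\<I>'\<close>. In the rooted tree, \<open>y \<in> Y\<close>
  connects the component of some \<open>b \<in> B\<close> to that of some \<open>c \<in> B\<close> above it, and distinct \<open>y\<close> have
  distinct \<open>b\<close>. Replacing \<open>y\<close> by any edge of the tree path from \<open>b\<close> to \<open>c\<close> still separates \<open>B\<close>, so
  \<open>y\<close> is a cheapest edge of that path. Some edge of the path leaves the part of \<open>\<Q>\<close> containing \<open>b\<close>
  and thus weighs at most the cut of this part. Therefore
  \<open>cr(\<P>) \<le> w\<^sub>H(C) \<le> w\<^sub>H(Y) \<le> d\<^sub>w(\<Q>) = 2 cr(\<Q>)\<close>, and together with \<open>cr(\<P>) \<le> W\<close> this gives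
  \<open>3 f(\<P>) \<le> 3 W + 2 (2 cr(\<Q>)) + W = 4 f(\<Q>)\<close>.\<close>

section \<open>Connectivity under deletion of edges\<close>

definition linked :: "'a set set \<Rightarrow> 'a \<Rightarrow> 'a \<Rightarrow> bool" where
  "linked A u v \<longleftrightarrow> (u, v) \<in> {(x, y). {x, y} \<in> A}\<^sup>*"

lemma linked_refl [simp]: "linked A u u"
  by (simp add: linked_def)

lemma linked_trans: "linked A u v \<Longrightarrow> linked A v x \<Longrightarrow> linked A u x"
  by (auto simp: linked_def intro: rtrancl_trans)

lemma linked_sym: "linked A u v \<Longrightarrow> linked A v u"
proof -
  have "sym {(x, y). {x, y} \<in> A}"
    by (auto simp: sym_def insert_commute)
  then show "linked A u v \<Longrightarrow> linked A v u"
    unfolding linked_def by (meson sym_rtrancl symD)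
qed

lemma linked_mono: "linked A u v \<Longrightarrow> A \<subseteq> B \<Longrightarrow> linked B u v"
  unfolding linked_def by (erule rtrancl_mono[THEN subsetD, rotated]) auto

lemma linked_Diff_mono: "linked (A - C) u v \<Longrightarrow> D \<subseteq> C \<Longrightarrow> linked (A - D) u v"
  by (erule linked_mono) blast

lemma linked_DiffD: "linked (A - C) u v \<Longrightarrow> linked A u v"
  by (erule linked_mono) blast

lemma linked_edge: "{u, v} \<in> A \<Longrightarrow> linked A u v"
  by (auto simp: linked_def)

lemma linked_closed:
  assumes "linked A u v" "u \<in> S" "\<And>x y. {x, y} \<in> A \<Longrightarrow> x \<in> S \<Longrightarrow> y \<in> S"
  shows "v \<in> S"
  using assms(1,2) unfolding linked_def
  by (induction rule: rtrancl_induct) (auto intro: assms(3))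

lemma linked_lostE:
  assumes "linked A u v" "\<not> linked (A - {e}) u v"
  obtains s t where "e = {s, t}" "e \<in> A" "linked (A - {e}) u s" "linked (A - {e}) t v"
proof -
  have "linked (A - {e}) u v \<or>
      (\<exists>s t. e = {s, t} \<and> e \<in> A \<and> linked (A - {e}) u s \<and> linked (A - {e}) t v)"
    using assms(1) unfolding linked_def[of A]
  proof (induction rule: rtrancl_induct)
    case base
    show ?case by simp
  next
    case (step x y)
    show ?case
    proof (cases "e = {x, y}")
      case True
      then have "linked (A - {e}) u x \<or> linked (A - {e}) u y"
        using step.IH by (auto simp: doubleton_eq_iff)
      then show ?thesis
        using True step.hyps(2) linked_refl[of "A - {e}" y] by blast
    next
      case False
      then have "linked (A - {e}) x y"
        using step.hyps(2) by (intro linked_edge) auto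
      then show ?thesis
        using step.IH linked_trans[of "A - {e}" _ x y] by blast
    qed
  qed
  then show thesis using assms(2) that by blast
qed

lemma linked_lost_same_ends:
  assumes "linked A u v" "\<not> linked (A - {e}) u v" "linked A x y" "\<not> linked (A - {e}) x y"
  shows "linked (A - {e}) u x \<and> linked (A - {e}) v y \<or> linked (A - {e}) u y \<and> linked (A - {e}) v x"
proof -
  obtain s t where st: "e = {s, t}" "linked (A - {e}) u s" "linked (A - {e}) t v"
    using assms(1,2) by (rule linked_lostE)
  obtain s' t' where s't': "e = {s', t'}" "linked (A - {e}) x s'" "linked (A - {e}) t' y"
    using assms(3,4) by (rule linked_lostE)
  consider "s' = s" "t' = t" | "s' = t" "t' = s"
    using st(1) s't'(1) by (auto simp: doubleton_eq_iff)
  then show ?thesis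
  proof cases
    case 1
    then show ?thesis
      using linked_trans[OF st(2) linked_sym[OF s't'(2)[unfolded 1]]]
        linked_trans[OF linked_sym[OF st(3)] s't'(3)[unfolded 1]] by blast
  next
    case 2
    then show ?thesis
      using linked_trans[OF st(2) s't'(3)[unfolded 2]]
        linked_trans[OF linked_sym[OF st(3)] linked_sym[OF s't'(2)[unfolded 2]]] by blast
  qed
qed

lemma linked_Diff_two_sides:
  assumes "linked A u v" "\<not> linked (A - {e}) u v" "linked A v x" "\<not> linked (A - {e}) v x"
  shows "linked (A - {e}) u x"
  using linked_lost_same_ends[OF assms] assms(2) by blast

lemma linked_of_lost_pairs:
  assumes "linked A u v" "\<not> linked (A - {e}) u v" "linked A x y" "\<not> linked (A - {e}) x y"
  shows "linked A u x"
  using linked_lost_same_ends[OF assms] linked_DiffD assms(3) linked_sym linked_trans by metis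

lemma component_eq_linked: "component V A u = {v \<in> V. linked A u v}"
  by (simp add: component_def linked_def)

lemma component_eq_iff:
  assumes "u \<in> V" "v \<in> V"
  shows "component V A u = component V A v \<longleftrightarrow> linked A u v"
proof
  have "v \<in> component V A v"
    using assms(2) by (simp add: component_eq_linked)
  moreover assume "component V A u = component V A v"
  ultimately have "v \<in> component V A u" by simp
  then show "linked A u v" by (simp add: component_eq_linked)
next
  assume "linked A u v"
  then have "linked A u x \<longleftrightarrow> linked A v x" for x
    using linked_sym linked_trans by metis
  then show "component V A u = component V A v"
    by (simp add: component_eq_linked)
qed

lemma partition_on_components: "partition_on V (components V A)"
proof -
  let ?r = "{(u, v). u \<in> V \<and> v \<in> V \<and> linked A u v}"
  have "equiv V ?r"
    by (intro equivI refl_onI symI transI) (auto intro: linked_sym linked_trans)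
  moreover have "components V A = V // ?r"
    by (auto simp: components_def component_eq_linked quotient_def)
  ultimately show ?thesis
    using partition_on_quotient by metis
qed

lemma graph_finite_edges: "graph V E \<Longrightarrow> finite E"
  unfolding graph_def by (meson PowI finite_Pow_iff finite_subset subsetI)

lemma graph_edgeE:
  assumes "graph V E" "e \<in> E"
  obtains u v where "e = {u, v}" "u \<noteq> v" "u \<in> V" "v \<in> V"
proof -
  have "e \<subseteq> V" "card e = 2" using assms by (auto simp: graph_def)
  then show thesis using that by (auto simp: card_2_iff)
qed

lemma path_edges_append: "path_edges ys \<subseteq> path_edges (xs @ ys)"
proof (induction xs)
  case Nil
  show ?case by simp
next
  case (Cons x xs)
  then show ?case by (cases "xs @ ys") auto
qed

lemma is_path_imp_linked:
  assumes "is_path V A s p t"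
  shows "linked A s t"
proof -
  have "p \<noteq> [] \<Longrightarrow> path_edges p \<subseteq> A \<Longrightarrow> linked A (hd p) (last p)"
  proof (induction p rule: path_edges.induct)
    case (1 x y xs)
    then show ?case using linked_trans[OF linked_edge[of x y A]] by auto
  qed auto
  then show ?thesis using assms by (auto simp: is_path_def)
qed

lemma linked_imp_ex_path:
  assumes "linked A u v" "v \<in> V" "\<Union>A \<subseteq> V"
  shows "\<exists>p. is_path V A u p v"
  using assms(1) unfolding linked_def
proof (induction rule: converse_rtrancl_induct)
  case base
  have "is_path V A v [v] v" using assms(2) by (simp add: is_path_def)
  then show ?case by blast
next
  case (step x y)
  then obtain p where p: "is_path V A y p v" by blast
  show ?case
  proof (cases "x \<in> set p")
    case True
    then obtain xs ys where ys: "p = xs @ x # ys" by (auto simp: in_set_conv_decomp)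
    have "path_edges (x # ys) \<subseteq> path_edges p"
      unfolding ys by (rule path_edges_append)
    then have "is_path V A x (x # ys) v" using p by (auto simp: is_path_def ys)
    then show ?thesis by blast
  next
    case False
    have "path_edges (x # p) \<subseteq> A"
      using p step(1) by (cases p) (auto simp: is_path_def)
    moreover have "x \<in> V" using step(1) assms(3) by auto
    ultimately have "is_path V A x (x # p) v" using p False by (auto simp: is_path_def)
    then show ?thesis by blast
  qed
qed

section \<open>Transversals of the components\<close>

definition transversal :: "'a set \<Rightarrow> 'a set set \<Rightarrow> 'a set \<Rightarrow> bool" where
  "transversal V A I \<longleftrightarrow>
     I \<subseteq> V \<and> (\<forall>u\<in>V. \<exists>i\<in>I. linked A u i) \<and> (\<forall>i\<in>I. \<forall>j\<in>I. linked A i j \<longrightarrow> i = j)"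

lemma transversalI:
  assumes "I \<subseteq> V" "\<And>u. u \<in> V \<Longrightarrow> \<exists>i\<in>I. linked A u i"
    "\<And>i j. i \<in> I \<Longrightarrow> j \<in> I \<Longrightarrow> linked A i j \<Longrightarrow> i = j"
  shows "transversal V A I"
  using assms by (auto simp: transversal_def)

lemma transversal_subset: "transversal V A I \<Longrightarrow> I \<subseteq> V"
  by (simp add: transversal_def)

lemma transversal_linkedE:
  assumes "transversal V A I" "u \<in> V"
  obtains i where "i \<in> I" "linked A u i"
  using assms by (auto simp: transversal_def)

lemma transversal_eqI:
  "transversal V A I \<Longrightarrow> i \<in> I \<Longrightarrow> j \<in> I \<Longrightarrow> linked A i j \<Longrightarrow> i = j"
  by (simp add: transversal_def)

lemma transversal_bij_betw_components:
  assumes "transversal V A I"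
  shows "bij_betw (component V A) I (components V A)"
proof -
  have "inj_on (component V A) I"
    using assms by (auto simp: inj_on_def transversal_def component_eq_iff subset_iff)
  moreover have "component V A ` I = components V A"
    using assms
    by (fastforce simp: components_def transversal_def component_eq_iff subset_iff image_iff)
  ultimately show ?thesis by (simp add: bij_betw_def)
qed

lemma transversal_card: "transversal V A I \<Longrightarrow> card I = card (components V A)"
  using transversal_bij_betw_components bij_betw_same_card by blast

lemma transversal_Int_component:
  assumes "transversal V A I" "K \<in> components V A"
  shows "card (I \<inter> K) = 1"
proof -
  obtain u where u: "u \<in> V" "K = component V A u" using assms(2) by (auto simp: components_def)
  obtain i where i: "i \<in> I" "linked A u i" using assms(1) u(1) by (rule transversal_linkedE)
  have "j = i" if "j \<in> I" "linked A u j" for j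
    using transversal_eqI[OF assms(1)] that i linked_sym linked_trans by metis
  then have "I \<inter> K = {i}"
    using i u(2) transversal_subset[OF assms(1)] unfolding component_eq_linked by blast
  then show ?thesis by simp
qed

lemma transversal_image_choice:
  assumes "\<And>K. K \<in> components V A \<Longrightarrow> v K \<in> K"
  shows "transversal V A (v ` components V A)"
proof -
  have in_components: "component V A u \<in> components V A" if "u \<in> V" for u
    using that by (simp add: components_def)
  have v: "v (component V A u) \<in> V" "linked A u (v (component V A u))" if "u \<in> V" for u
    using assms[OF in_components[OF that]] by (auto simp: component_eq_linked)
  show ?thesis
  proof (rule transversalI)
    show "v ` components V A \<subseteq> V"
      using v(1) by (auto simp: components_def)
    show "\<exists>i\<in>v ` components V A. linked A u i" if "u \<in> V" for u
      using v(2)[OF that] in_components[OF that] by blast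
    fix i j assume "i \<in> v ` components V A" "j \<in> v ` components V A" and ij: "linked A i j"
    then obtain a b where ab: "a \<in> V" "i = v (component V A a)" "b \<in> V" "j = v (component V A b)"
      by (auto simp: components_def)
    then have "linked A a b"
      using v(2) ij linked_sym linked_trans by metis
    then show "i = j" using ab component_eq_iff by metis
  qed
qed

lemma ex_transversal_subset:
  assumes "I \<subseteq> V" "\<And>u. u \<in> V \<Longrightarrow> \<exists>i\<in>I. linked A u i"
  shows "\<exists>J\<subseteq>I. transversal V A J"
proof -
  let ?v = "\<lambda>K. SOME i. i \<in> I \<inter> K"
  have v: "?v K \<in> I \<inter> K" if K: "K \<in> components V A" for K
  proof (rule someI_ex)
    obtain u where "u \<in> V" "K = component V A u" using K by (auto simp: components_def)
    then show "\<exists>i. i \<in> I \<inter> K"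
      using assms by (fastforce simp: component_eq_linked)
  qed
  then have "transversal V A (?v ` components V A)"
    by (intro transversal_image_choice) blast
  moreover have "?v ` components V A \<subseteq> I" using v by blast
  ultimately show ?thesis by blast
qed

lemma transversal_exchange_vertex:
  assumes I: "transversal V A I" and u: "u \<in> I" and z: "z \<in> V" "linked A z u"
  shows "transversal V A (insert z (I - {u}))"
proof (rule transversalI)
  show "insert z (I - {u}) \<subseteq> V"
    using z(1) transversal_subset[OF I] by blast
  show "\<exists>i\<in>insert z (I - {u}). linked A a i" if a: "a \<in> V" for a
  proof -
    obtain i where "i \<in> I" "linked A a i" using I a by (rule transversal_linkedE)
    then show ?thesis using z(2) linked_sym linked_trans by (metis Diff_iff insert_iff singletonD)
  qed
  have "i = u" if "i \<in> I" "linked A z i \<or> linked A i z" for i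
    using transversal_eqI[OF I that(1) u] that(2) z(2) linked_sym linked_trans by metis
  then show "i = j" if "i \<in> insert z (I - {u})" "j \<in> insert z (I - {u})" "linked A i j" for i j
    using that transversal_eqI[OF I] by blast
qed

lemma transversal_insert:
  assumes I: "transversal V A I" and u: "u \<in> I" and z: "z \<in> V" "linked A z u"
    and lost: "\<not> linked (A - {e}) z u"
  shows "transversal V (A - {e}) (insert z I)"
proof (rule transversalI)
  show "insert z I \<subseteq> V"
    using z(1) transversal_subset[OF I] by blast
  show "\<exists>i\<in>insert z I. linked (A - {e}) a i" if a: "a \<in> V" for a
  proof -
    obtain i where "i \<in> I" "linked A a i" using I a by (rule transversal_linkedE)
    then show ?thesis
      using linked_lost_same_ends[of A a i e z u] z(2) lost u by blast
  qed
  have "\<not> linked (A - {e}) z i \<and> \<not> linked (A - {e}) i z" if i: "i \<in> I" for i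
    using transversal_eqI[OF I i u] z(2) lost linked_DiffD[of A "{e}"] linked_sym linked_trans
    by metis
  then show "i = j" if "i \<in> insert z I" "j \<in> insert z I" "linked (A - {e}) i j" for i j
    using that transversal_eqI[OF I] linked_DiffD[of A "{e}"] by blast
qed

lemma transversal_Diff_insert:
  assumes "transversal V (A - X) I" "u \<in> I" "z \<in> V" "linked (A - X) z u" "\<not> linked (A - {e}) z u"
  shows "transversal V (A - insert e X) (insert z I)"
proof -
  have "\<not> linked (A - insert e X) z u"
    using assms(5) linked_Diff_mono[of A "insert e X" z u "{e}"] by blast
  then show ?thesis
    unfolding Diff_insert[of A e X] by (rule transversal_insert[OF assms(1-4)])
qed

lemma transversal_exchange_edge:
  assumes I: "transversal V (A - {d}) I" and joined: "b \<in> I" "c \<in> I" "linked A b c"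
    and lost: "\<not> linked (A - {e}) b c"
  shows "transversal V (A - {e}) I"
proof (rule transversalI)
  show "I \<subseteq> V" using transversal_subset[OF I] .
  show "\<exists>i\<in>I. linked (A - {e}) a i" if a: "a \<in> V" for a
  proof -
    obtain i where "i \<in> I" "linked (A - {d}) a i" using I a by (rule transversal_linkedE)
    then show ?thesis
      using linked_lost_same_ends[of A a i e b c] linked_DiffD[of A "{d}"] joined lost by blast
  qed
  have "\<not> linked (A - {d}) b c"
    using transversal_eqI[OF I joined(1,2)] lost by auto
  then have "linked (A - {d}) i j \<or> (i = b \<and> j = c) \<or> (i = c \<and> j = b)"
    if "i \<in> I" "j \<in> I" "linked A i j" for i j
    using linked_lost_same_ends[of A i j d b c] transversal_eqI[OF I] that joined by blast
  then show "i = j" if "i \<in> I" "j \<in> I" "linked (A - {e}) i j" for i j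
    using that transversal_eqI[OF I] linked_DiffD[of A "{e}"] lost linked_sym by metis
qed

section \<open>Matroids and the greedy algorithm\<close>

definition min_weight ::
  "'a set set \<Rightarrow> ('a \<Rightarrow> 'b::{linorder,ordered_comm_monoid_add}) \<Rightarrow> 'a set \<Rightarrow> bool" where
  "min_weight \<I> w C \<longleftrightarrow> C \<in> \<I> \<and> (\<forall>Y\<in>\<I>. card Y = card C \<longrightarrow> sum w C \<le> sum w Y)"

definition greedy_step ::
  "'a set \<Rightarrow> 'a set set \<Rightarrow> ('a \<Rightarrow> 'b::linorder) \<Rightarrow> 'a set \<Rightarrow> 'a set \<Rightarrow> bool" where
  "greedy_step V \<I> w C C' \<longleftrightarrow>
     (\<exists>e. is_arg_min w (\<lambda>e. e \<in> V - C \<and> insert e C \<in> \<I>) e \<and> C' = insert e C)"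

context matroid
begin

lemma finite_indep_sets: "finite \<I>"
  using finite_ground indep_subset by (meson PowI finite_Pow_iff finite_subset subsetI)

lemma finite_indep: "I \<in> \<I> \<Longrightarrow> finite I"
  using finite_ground indep_subset finite_subset by metis

lemma card_indep_le_rank: "I \<in> \<I> \<Longrightarrow> card I \<le> matroid_rank \<I>"
  unfolding matroid_rank_def using finite_indep_sets by simp

lemma ex_indep_card_eq_rank: "\<exists>I\<in>\<I>. card I = matroid_rank \<I>"
proof -
  have "Max (card ` \<I>) \<in> card ` \<I>"
    using finite_indep_sets empty_indep by (intro Max_in) auto
  then show ?thesis by (auto simp: matroid_rank_def)
qed

lemma ex_indep_insert:
  assumes "I \<in> \<I>" "card I < matroid_rank \<I>"
  shows "\<exists>y. y \<notin> I \<and> insert y I \<in> \<I>"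
proof -
  obtain J where "J \<in> \<I>" "card J = matroid_rank \<I>" using ex_indep_card_eq_rank by blast
  then show ?thesis using indep_augment[OF assms(1), of J] assms(2) by auto
qed

lemma basis_iff_card_eq_rank: "basis \<I> B \<longleftrightarrow> B \<in> \<I> \<and> card B = matroid_rank \<I>"
proof
  assume B: "basis \<I> B"
  then have "B \<in> \<I>" by (simp add: basis_def)
  moreover have "\<not> card B < matroid_rank \<I>"
    using ex_indep_insert[OF \<open>B \<in> \<I>\<close>] B by (auto simp: basis_def)
  ultimately show "B \<in> \<I> \<and> card B = matroid_rank \<I>"
    using card_indep_le_rank by (simp add: order.antisym)
next
  assume B: "B \<in> \<I> \<and> card B = matroid_rank \<I>"
  then have "X = B" if "X \<in> \<I>" "B \<subseteq> X" for X
    using card_seteq[of X B] that finite_indep card_indep_le_rank by auto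
  then show "basis \<I> B" using B by (simp add: basis_def)
qed

lemma greedy_step_min_weight:
  assumes C: "min_weight \<I> w C" and "greedy_step V \<I> w C C'"
  shows "min_weight \<I> w C'"
proof -
  obtain e where e: "e \<notin> C" "insert e C \<in> \<I>" "C' = insert e C"
    and cheapest: "\<And>y. y \<in> V - C \<Longrightarrow> insert y C \<in> \<I> \<Longrightarrow> w e \<le> w y"
    using assms(2) by (auto simp: greedy_step_def is_arg_min_linorder)
  have indep_C: "C \<in> \<I>" using C by (simp add: min_weight_def)
  have "sum w C' \<le> sum w Y" if Y: "Y \<in> \<I>" "card Y = card C'" for Y
  proof -
    have card_Y: "card Y = Suc (card C)" using Y(2) e finite_indep[OF indep_C] by simp
    then obtain y where y: "y \<in> Y - C" "insert y C \<in> \<I>"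
      using indep_augment[OF indep_C Y(1)] by auto
    have "sum w C' = w e + sum w C"
      using e finite_indep[OF indep_C] by simp
    also have "\<dots> \<le> w y + sum w (Y - {y})"
    proof (rule add_mono)
      show "w e \<le> w y"
        using cheapest[of y] y indep_subset[OF Y(1)] by blast
      show "sum w C \<le> sum w (Y - {y})"
        using C indep_hereditary[OF Y(1)] card_Y y(1) by (simp add: min_weight_def)
    qed
    also have "\<dots> = sum w Y"
      using sum.remove[OF finite_indep[OF Y(1)], of y w] y(1) by simp
    finally show ?thesis .
  qed
  then show ?thesis using e by (simp add: min_weight_def)
qed

lemma greedy_run_min_weight:
  assumes "(greedy_step V \<I> w)\<^sup>*\<^sup>* {} C"
  shows "min_weight \<I> w C"
  using assms
proof (induction rule: rtranclp_induct)
  case base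
  have "sum w Y = 0" if "Y \<in> \<I>" "card Y = 0" for Y
    using that finite_indep by simp
  then show ?case using empty_indep by (simp add: min_weight_def)
next
  case (step C C')
  then show ?case using greedy_step_min_weight by blast
qed

lemma ex_greedy_step:
  assumes "C \<in> \<I>" "card C < matroid_rank \<I>"
  shows "\<exists>C'. greedy_step V \<I> w C C'"
proof -
  let ?S = "{e. e \<in> V - C \<and> insert e C \<in> \<I>}"
  obtain y where "y \<notin> C" "insert y C \<in> \<I>" using ex_indep_insert[OF assms] by blast
  then have "y \<in> ?S" using indep_subset[of "insert y C"] by auto
  then have "finite ?S" "?S \<noteq> {}" using finite_ground by auto
  then obtain e where "is_arg_min w (\<lambda>e. e \<in> ?S) e"
    using ex_is_arg_min_if_finite by metis
  then show ?thesis by (auto simp: greedy_step_def)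
qed

text \<open>Choose \<open>I\<close> with the largest overlap with \<open>J\<close>, let \<open>z \<in> J\<close> augment it, and let \<open>u\<close> be the
  representative of \<open>z\<close> in \<open>I\<close>. If \<open>A'\<close> linked \<open>z\<close> and \<open>u\<close>, then \<open>u\<close> would not lie in \<open>J\<close>, and
  exchanging it for \<open>z\<close> would increase the overlap.\<close>

lemma obtain_separating_augmentation:
  assumes "I\<^sub>0 \<in> \<I>" "transversal V A I\<^sub>0" and J: "J \<in> \<I>" "transversal V A' J"
    and smaller: "card I\<^sub>0 < card J"
  obtains I z u where "transversal V A I" "u \<in> I" "z \<in> V" "insert z I \<in> \<I>"
    "linked A z u" "\<not> linked A' z u"
proof -
  have "\<exists>I. (I \<in> \<I> \<and> transversal V A I) \<and>
      (\<forall>I'. I' \<in> \<I> \<and> transversal V A I' \<longrightarrow> card (I' \<inter> J) \<le> card (I \<inter> J))"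
    by (rule ex_has_greatest_nat[where k = I\<^sub>0 and b = "Suc (card J)"])
      (use assms(1,2) finite_indep[OF J(1)] in \<open>auto intro: card_mono simp: less_Suc_eq_le\<close>)
  then obtain I where I: "I \<in> \<I>" "transversal V A I"
    and largest: "\<And>I'. I' \<in> \<I> \<Longrightarrow> transversal V A I' \<Longrightarrow> card (I' \<inter> J) \<le> card (I \<inter> J)"
    by blast
  have "card I < card J"
    using transversal_card[OF I(2)] transversal_card[OF assms(2)] smaller by simp
  then obtain z where z: "z \<in> J" "z \<notin> I" "insert z I \<in> \<I>"
    using indep_augment[OF I(1) J(1)] by blast
  have "z \<in> V" using z(1) indep_subset[OF J(1)] by blast
  with I(2) obtain u where u: "u \<in> I" "linked A z u" by (rule transversal_linkedE)
  have "\<not> linked A' z u"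
  proof
    assume "linked A' z u"
    then have "u \<notin> J" using transversal_eqI[OF J(2) z(1)] u(1) z(2) by blast
    then have "insert z (I - {u}) \<inter> J = insert z (I \<inter> J)" using z(1) by blast
    then have "card (insert z (I - {u}) \<inter> J) = Suc (card (I \<inter> J))"
      using z(2) finite_indep[OF I(1)] by simp
    moreover have "insert z (I - {u}) \<in> \<I>" by (rule indep_hereditary[OF z(3)]) blast
    moreover have "transversal V A (insert z (I - {u}))"
      using I(2) u(1) \<open>z \<in> V\<close> u(2) by (rule transversal_exchange_vertex)
    ultimately show False using largest[of "insert z (I - {u})"] by simp
  qed
  then show thesis using that I(2) u \<open>z \<in> V\<close> z(3) by blast
qed

end

section \<open>Deleting edges from a tree\<close>

locale tree_graph =
  fixes V :: "'a set" and F :: "'a set set"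
  assumes tree: "tree V F"
begin

lemma graph: "graph V F"
  using tree by (simp add: tree_def)

lemma vertices_nonempty: "V \<noteq> {}"
  using tree by (simp add: tree_def)

lemma finite_vertices: "finite V"
  using graph by (simp add: graph_def)

lemma edge_subset: "e \<in> F \<Longrightarrow> e \<subseteq> V"
  using graph by (simp add: graph_def)

lemmas finite_edges = graph_finite_edges[OF graph]

lemmas edgeE = graph_edgeE[OF graph]

lemma linked_tree: "u \<in> V \<Longrightarrow> v \<in> V \<Longrightarrow> linked F u v"
  using tree is_path_imp_linked unfolding tree_def by metis

lemma edge_is_bridge:
  assumes "{s, t} \<in> F"
  shows "\<not> linked (F - {{s, t}}) s t"
proof
  assume detour: "linked (F - {{s, t}}) s t"
  have st: "s \<noteq> t" "t \<in> V" using edgeE[OF assms] by (metis doubleton_eq_iff)+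
  obtain p where p: "is_path V (F - {{s, t}}) s p t"
    using linked_imp_ex_path[OF detour st(2)] edge_subset by blast
  have "length p \<ge> 3"
  proof (rule ccontr)
    assume "\<not> length p \<ge> 3"
    then consider "p = []" | x where "p = [x]" | x y where "p = [x, y]"
      by (cases p rule: path_edges.cases) (auto simp: not_le less_Suc_eq)
    then show False using p st(1) by cases (auto simp: is_path_def)
  qed
  moreover have "is_path V F s p t" using p by (auto simp: is_path_def)
  moreover have "{t, s} \<in> F" using assms by (simp add: insert_commute)
  ultimately show False using tree unfolding tree_def by blast
qed

lemma linked_Diff_iff:
  assumes "u \<in> V" "v \<in> V"
  shows "linked (F - C) u v \<longleftrightarrow> (\<forall>e\<in>C. linked (F - {e}) u v)"
proof
  show "linked (F - C) u v \<Longrightarrow> \<forall>e\<in>C. linked (F - {e}) u v"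
    by (auto intro: linked_Diff_mono)
next
  have finite_deletion: "linked (F - D) u v" if "finite D" "\<forall>e\<in>D. linked (F - {e}) u v" for D
    using that
  proof (induction D rule: finite_induct)
    case empty
    show ?case using linked_tree assms by simp
  next
    case (insert e D)
    show ?case
    proof (rule ccontr)
      assume "\<not> linked (F - insert e D) u v"
      then have lost: "\<not> linked (F - D - {e}) u v" unfolding Diff_insert[of F e D] .
      have "linked (F - D) u v" using insert by blast
      then obtain s t where st: "e = {s, t}" "e \<in> F - D"
        "linked (F - D - {e}) u s" "linked (F - D - {e}) t v"
        using lost by (rule linked_lostE)
      have "linked (F - {e}) u s" "linked (F - {e}) t v"
        using st(3,4) by (auto elim: linked_mono)
      then have "linked (F - {e}) s t"
        using insert.prems linked_sym linked_trans by (metis insertI1)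
      then show False using edge_is_bridge st(1,2) by blast
    qed
  qed
  assume "\<forall>e\<in>C. linked (F - {e}) u v"
  then have "linked (F - (C \<inter> F)) u v"
    using finite_edges by (intro finite_deletion) auto
  then show "linked (F - C) u v" by (rule linked_mono) blast
qed

lemma obtain_separating_edge:
  assumes "u \<in> V" "v \<in> V" "\<not> linked (F - C) u v"
  obtains e where "e \<in> C" "e \<in> F" "\<not> linked (F - {e}) u v"
proof -
  obtain e where e: "e \<in> C" "\<not> linked (F - {e}) u v"
    using linked_Diff_iff[OF assms(1,2)] assms(3) by blast
  moreover have "e \<in> F"
    using e(2) linked_tree[OF assms(1,2)] by (metis Diff_insert0 Diff_empty)
  ultimately show thesis using that by blast
qed

lemma obtain_separating_crossing_edge:
  assumes "u \<in> V" "v \<in> V" "u \<in> S" "v \<notin> S"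
  obtains s t where "{s, t} \<in> F" "s \<in> S" "t \<notin> S" "\<not> linked (F - {{s, t}}) u v"
proof -
  let ?C = "{{s, t} | s t. s \<in> S \<and> t \<notin> S}"
  have "\<not> linked (F - ?C) u v"
    using linked_closed[of "F - ?C" u v S] assms(3,4) by blast
  with assms(1,2) obtain e where "e \<in> ?C" "e \<in> F" "\<not> linked (F - {e}) u v"
    by (rule obtain_separating_edge)
  then show thesis using that by blast
qed

lemma linked_if_both_separated:
  assumes "u \<in> V" "v \<in> V" "x \<in> V" "\<not> linked (F - {e}) u v" "\<not> linked (F - {e}) v x"
  shows "linked (F - {e}) u x"
  using linked_Diff_two_sides assms(4,5) linked_tree[OF assms(1,2)] linked_tree[OF assms(2,3)]
  by metis

definition fundamental_cut :: "'a set \<Rightarrow> 'a set" where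
  "fundamental_cut e = component V (F - {e}) (SOME s. s \<in> e)"

lemma fundamental_cut_separates:
  assumes "e \<in> F" "u \<in> V" "v \<in> V" "\<not> linked (F - {e}) u v"
  shows "(u \<in> fundamental_cut e) \<noteq> (v \<in> fundamental_cut e)"
proof -
  let ?s = "SOME s. s \<in> e"
  have "?s \<in> e" using edgeE[OF assms(1)] by (metis insertI1 someI)
  then have "?s \<in> V" using edge_subset assms(1) by blast
  then have "linked (F - {e}) ?s u \<noteq> linked (F - {e}) ?s v"
    using linked_if_both_separated[OF assms(2) _ assms(3)] assms(4) linked_sym linked_trans by metis
  then show ?thesis using assms(2,3) by (simp add: fundamental_cut_def component_eq_linked)
qed

lemma card_components_Diff:
  assumes "X \<subseteq> F"
  shows "card (components V (F - X)) = Suc (card X)"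
proof -
  have "finite X" using assms finite_edges finite_subset by blast
  then show ?thesis using assms
  proof (induction X rule: finite_induct)
    case empty
    have "component V F u = V" if "u \<in> V" for u
      using linked_tree that by (auto simp: component_eq_linked)
    then have "components V F = {V}" using vertices_nonempty by (auto simp: components_def)
    then show ?case by simp
  next
    case (insert e X)
    obtain s t where e: "e = {s, t}" "s \<in> V" "t \<in> V" using insert.prems edgeE[of e] by blast
    obtain I where I: "transversal V (F - X) I"
      using ex_transversal_subset[of V V "F - X"] by (metis linked_refl order_refl)
    obtain u where u: "u \<in> I" "linked (F - X) s u" using I e(2) by (rule transversal_linkedE)
    have "linked (F - X) t s"
      using insert e(1) by (intro linked_edge) (simp add: insert_commute)
    then have "linked (F - X) t u" using u(2) by (rule linked_trans)
    moreover have "\<not> linked (F - {e}) s t" using edge_is_bridge e(1) insert.prems by blast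
    then have "\<not> linked (F - {e}) s u \<or> \<not> linked (F - {e}) t u"
      using linked_sym linked_trans by metis
    ultimately obtain z where z: "z \<in> V" "linked (F - X) z u" "\<not> linked (F - {e}) z u"
      using u(2) e(2,3) by blast
    have "transversal V (F - insert e X) (insert z I)"
      using I u(1) z by (rule transversal_Diff_insert)
    moreover have "z \<notin> I" using transversal_eqI[OF I _ u(1) z(2)] z(3) by auto
    moreover have "finite I" using transversal_subset[OF I] finite_vertices finite_subset by blast
    ultimately show ?case
      using insert transversal_card[OF I] transversal_card[of V "F - insert e X" "insert z I"]
      by simp
  qed
qed

lemma card_transversal_Diff:
  "transversal V (F - X) I \<Longrightarrow> X \<subseteq> F \<Longrightarrow> card I = Suc (card X)"
  by (simp add: transversal_card card_components_Diff)

definition separating_sets :: "'a set \<Rightarrow> 'a set set set" where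
  "separating_sets B = {Y. Y \<subseteq> F \<and> transversal V (F - Y) B}"

lemma separating_sets_nonempty:
  assumes "B \<subseteq> V" "B \<noteq> {}"
  shows "separating_sets B \<noteq> {}"
proof -
  have "finite B" using assms(1) finite_vertices finite_subset by blast
  then have "\<exists>Y\<subseteq>F. transversal V (F - Y) B" using assms(2,1)
  proof (induction B rule: finite_ne_induct)
    case (singleton b)
    then have "transversal V F {b}" using linked_tree by (intro transversalI) auto
    then show ?case by (metis Diff_empty empty_subsetI)
  next
    case (insert z B)
    then obtain Y where Y: "Y \<subseteq> F" "transversal V (F - Y) B" by blast
    have "z \<in> V" using insert.prems by simp
    with Y(2) obtain u where u: "u \<in> B" "linked (F - Y) z u" by (rule transversal_linkedE)
    have "u \<in> V" "u \<notin> {z}" using u(1) insert by auto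
    obtain s t where st: "{s, t} \<in> F" "\<not> linked (F - {{s, t}}) z u"
      using \<open>z \<in> V\<close> \<open>u \<in> V\<close> _ \<open>u \<notin> {z}\<close> by (rule obtain_separating_crossing_edge) simp_all
    have "transversal V (F - insert {s, t} Y) (insert z B)"
      using Y(2) u(1) \<open>z \<in> V\<close> u(2) st(2) by (rule transversal_Diff_insert)
    then show ?case using st(1) Y(1) by (metis insert_subset)
  qed
  then show ?thesis by (auto simp: separating_sets_def)
qed

lemma separating_sets_exchange:
  assumes Y: "Y \<in> separating_sets B" and y: "y \<in> Y"
    and joined: "b \<in> B" "c \<in> B" "linked (F - (Y - {y})) b c"
    and e: "e \<in> F" "\<not> linked (F - {e}) b c"
  shows "e \<notin> Y - {y}" "insert e (Y - {y}) \<in> separating_sets B"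
proof -
  show "e \<notin> Y - {y}"
    using joined(3) e(2) linked_Diff_mono[of F "Y - {y}" b c "{e}"] by blast
  have "F - (Y - {y}) - {y} = F - Y" using y by blast
  then have "transversal V (F - (Y - {y}) - {y}) B"
    using Y by (simp only: separating_sets_def mem_Collect_eq)
  moreover have "\<not> linked (F - (Y - {y}) - {e}) b c"
    using e(2) by (metis Diff_insert insertI1 linked_Diff_mono singletonD subsetI)
  ultimately have "transversal V (F - (Y - {y}) - {e}) B"
    by (rule transversal_exchange_edge[OF _ joined])
  then have "transversal V (F - insert e (Y - {y})) B" unfolding Diff_insert[of F e "Y - {y}"] .
  then show "insert e (Y - {y}) \<in> separating_sets B"
    using Y e(1) by (auto simp: separating_sets_def)
qed

text \<open>Root the tree at \<open>r\<close>: restoring the deleted edge \<open>y\<close> joins the component of \<open>b\<close>, below \<open>y\<close>,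
  to that of \<open>c\<close>, above \<open>y\<close>.\<close>

definition hangs_below :: "'a \<Rightarrow> 'a set set \<Rightarrow> 'a set \<Rightarrow> 'a \<Rightarrow> 'a \<Rightarrow> bool" where
  "hangs_below r Y y b c \<longleftrightarrow>
     linked (F - (Y - {y})) b c \<and> \<not> linked (F - {y}) b r \<and> linked (F - {y}) c r"

lemma hangs_below_separated: "hangs_below r Y y b c \<Longrightarrow> \<not> linked (F - {y}) b c"
  unfolding hangs_below_def using linked_trans by metis

lemma obtain_lower_end:
  assumes "e \<in> F" "r \<in> V"
  obtains s t where "e = {s, t}" "s \<in> V" "t \<in> V"
    "\<not> linked (F - {e}) s r" "linked (F - {e}) t r"
proof -
  obtain a b where ab: "e = {a, b}" "a \<in> V" "b \<in> V" using assms(1) by (rule edgeE)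
  have "\<not> linked (F - {e}) a b" using edge_is_bridge assms(1) ab(1) by blast
  then have "linked (F - {e}) a r \<longleftrightarrow> \<not> linked (F - {e}) b r"
    using linked_if_both_separated[OF ab(2) assms(2) ab(3)] linked_sym linked_trans by metis
  then show thesis using that ab by (metis insert_commute)
qed

lemma ex_hangs_below:
  assumes Y: "Y \<in> separating_sets B" "y \<in> Y" and r: "r \<in> V"
  shows "\<exists>b\<in>B. \<exists>c\<in>B. hangs_below r Y y b c"
proof -
  have B: "transversal V (F - Y) B" and y: "y \<in> F"
    using Y by (auto simp: separating_sets_def)
  obtain s t where st: "y = {s, t}" "s \<in> V" "t \<in> V"
    "\<not> linked (F - {y}) s r" "linked (F - {y}) t r"
    using y r by (rule obtain_lower_end)
  obtain b where b: "b \<in> B" "linked (F - Y) s b" using B st(2) by (rule transversal_linkedE)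
  obtain c where c: "c \<in> B" "linked (F - Y) t c" using B st(3) by (rule transversal_linkedE)
  have fewer_deleted: "linked (F - {y}) x z" "linked (F - (Y - {y})) x z"
    if "linked (F - Y) x z" for x z
    using that Y(2) by (auto elim: linked_Diff_mono)
  have "linked (F - (Y - {y})) s t" using st(1) y by (intro linked_edge) simp
  then have "linked (F - (Y - {y})) b c"
    using fewer_deleted b(2) c(2) linked_sym linked_trans by metis
  moreover have "\<not> linked (F - {y}) b r"
    using fewer_deleted b(2) st(4) linked_trans by metis
  moreover have "linked (F - {y}) c r"
    using fewer_deleted c(2) st(5) linked_sym linked_trans by metis
  ultimately show ?thesis using b(1) c(1) unfolding hangs_below_def by blast
qed

text \<open>Otherwise \<open>r\<close>, \<open>b\<close>, \<open>c\<close> and \<open>c'\<close> would lie in the four different intersections of a side of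
  \<open>y\<close> with a side of \<open>y'\<close>, but in a tree one of these is empty.\<close>

lemma hangs_below_edge_unique:
  assumes y: "y \<in> Y" "hangs_below r Y y b c" and y': "y' \<in> Y" "hangs_below r Y y' b c'"
  shows "y = y'"
proof (rule ccontr)
  assume "y \<noteq> y'"
  have c: "linked (F - {y'}) b c" "\<not> linked (F - {y}) b r" "linked (F - {y}) c r"
    using y(2) y'(1) \<open>y \<noteq> y'\<close> linked_Diff_mono[of F "Y - {y}" b c "{y'}"]
    unfolding hangs_below_def by blast+
  have c': "linked (F - {y}) b c'" "\<not> linked (F - {y'}) b r" "linked (F - {y'}) c' r"
    using y'(2) y(1) \<open>y \<noteq> y'\<close> linked_Diff_mono[of F "Y - {y'}" b c' "{y}"]
    unfolding hangs_below_def by blast+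
  have "\<not> linked (F - {y'}) c r" "\<not> linked (F - {y'}) b c'"
    using c(1) c'(2,3) linked_trans by metis+
  then have lost: "\<not> linked (F - {y} - {y'}) c r" "\<not> linked (F - {y} - {y'}) b c'"
    using linked_mono[of "F - {y} - {y'}" _ _ "F - {y'}"] by blast+
  have "linked (F - {y}) c b"
    by (rule linked_of_lost_pairs[OF c(3) lost(1) c'(1) lost(2)])
  then have "linked (F - {y}) b r"
    using c(3) by (rule linked_trans[OF linked_sym])
  then show False using c(2) by contradiction
qed

lemma obtain_separated_representatives:
  assumes "Y \<in> separating_sets B"
  obtains \<beta> \<gamma> where "inj_on \<beta> Y" "\<And>y. y \<in> Y \<Longrightarrow> \<beta> y \<in> B" "\<And>y. y \<in> Y \<Longrightarrow> \<gamma> y \<in> B"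
    "\<And>y. y \<in> Y \<Longrightarrow> linked (F - (Y - {y})) (\<beta> y) (\<gamma> y)"
    "\<And>y. y \<in> Y \<Longrightarrow> \<not> linked (F - {y}) (\<beta> y) (\<gamma> y)"
proof -
  obtain r where r: "r \<in> V" using vertices_nonempty by blast
  obtain \<beta> \<gamma> where hangs: "\<And>y. y \<in> Y \<Longrightarrow> \<beta> y \<in> B \<and> \<gamma> y \<in> B \<and> hangs_below r Y y (\<beta> y) (\<gamma> y)"
    using ex_hangs_below[OF assms _ r] by metis
  have "inj_on \<beta> Y"
    using hangs hangs_below_edge_unique by (metis inj_onI)
  then show thesis
    using that hangs hangs_below_separated unfolding hangs_below_def by blast
qed

end

section \<open>The matroid on the tree edges\<close>

locale tree_matroid = tree_graph V F + matroid V \<I>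
  for V :: "'a set" and F :: "'a set set" and \<I> :: "'a set set" +
  assumes rank_pos: "matroid_rank \<I> \<ge> 1"
begin

lemma tree_indep_iff:
  "X \<in> tree_indep V \<I> F \<longleftrightarrow> X \<subseteq> F \<and> (\<exists>I\<in>\<I>. transversal V (F - X) I)"
proof
  assume "X \<in> tree_indep V \<I> F"
  then show "X \<subseteq> F \<and> (\<exists>I\<in>\<I>. transversal V (F - X) I)"
    unfolding tree_indep_def using transversal_image_choice by fast
next
  assume "X \<subseteq> F \<and> (\<exists>I\<in>\<I>. transversal V (F - X) I)"
  then obtain I where X: "X \<subseteq> F" and I: "I \<in> \<I>" "transversal V (F - X) I" by blast
  let ?v = "inv_into I (component V (F - X))"
  have bij: "bij_betw (component V (F - X)) I (components V (F - X))"
    using transversal_bij_betw_components[OF I(2)] .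
  have "?v K \<in> K" if "K \<in> components V (F - X)" for K
  proof -
    have "?v K \<in> I" "component V (F - X) (?v K) = K"
      using bij_betw_inv_into_right[OF bij that] bij_betwE[OF bij_betw_inv_into[OF bij]] that
      by blast+
    then show ?thesis using indep_subset[OF I(1)] by (auto simp: component_eq_linked)
  qed
  moreover have "?v ` components V (F - X) = I"
    using bij_betw_inv_into[OF bij] by (rule bij_betw_imp_surj_on)
  ultimately show "X \<in> tree_indep V \<I> F"
    using X I(1) unfolding tree_indep_def by (intro CollectI conjI exI[of _ ?v]) simp_all
qed

lemma tree_indepE:
  assumes "X \<in> tree_indep V \<I> F"
  obtains I where "X \<subseteq> F" "I \<in> \<I>" "transversal V (F - X) I" "card I = Suc (card X)"
  using assms card_transversal_Diff unfolding tree_indep_iff by blast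

lemma empty_tree_indep: "{} \<in> tree_indep V \<I> F"
proof -
  obtain y where "{y} \<in> \<I>" using ex_indep_insert[OF empty_indep] rank_pos by auto
  moreover from this have "transversal V F {y}"
    using indep_subset linked_tree by (intro transversalI) auto
  ultimately show ?thesis by (auto simp: tree_indep_iff)
qed

lemma tree_indep_hereditary:
  assumes "Y \<in> tree_indep V \<I> F" "X \<subseteq> Y"
  shows "X \<in> tree_indep V \<I> F"
proof -
  obtain I where I: "Y \<subseteq> F" "I \<in> \<I>" "transversal V (F - Y) I" using assms(1) by (rule tree_indepE)
  have "\<exists>i\<in>I. linked (F - X) u i" if "u \<in> V" for u
  proof -
    obtain i where "i \<in> I" "linked (F - Y) u i" using I(3) \<open>u \<in> V\<close> by (rule transversal_linkedE)
    then show ?thesis using assms(2) linked_Diff_mono by metis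
  qed
  then obtain J where "J \<subseteq> I" "transversal V (F - X) J"
    using ex_transversal_subset[OF indep_subset[OF I(2)]] by blast
  then show ?thesis
    using I(1,2) assms(2) indep_hereditary by (auto simp: tree_indep_iff)
qed

lemma tree_indep_augment:
  assumes "X \<in> tree_indep V \<I> F" "Y \<in> tree_indep V \<I> F" "card X < card Y"
  shows "\<exists>y\<in>Y - X. insert y X \<in> tree_indep V \<I> F"
proof -
  obtain I\<^sub>0 where I\<^sub>0: "X \<subseteq> F" "I\<^sub>0 \<in> \<I>" "transversal V (F - X) I\<^sub>0" "card I\<^sub>0 = Suc (card X)"
    using assms(1) by (rule tree_indepE)
  obtain J where J: "Y \<subseteq> F" "J \<in> \<I>" "transversal V (F - Y) J" "card J = Suc (card Y)"
    using assms(2) by (rule tree_indepE)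
  have "card I\<^sub>0 < card J" using I\<^sub>0(4) J(4) assms(3) by simp
  with I\<^sub>0(2,3) J(2,3) obtain I z u where I: "transversal V (F - X) I" "u \<in> I"
    and z: "z \<in> V" "insert z I \<in> \<I>" "linked (F - X) z u" "\<not> linked (F - Y) z u"
    by (rule obtain_separating_augmentation)
  have "u \<in> V" using I transversal_subset by blast
  with z(1) obtain y where y: "y \<in> Y" "y \<in> F" "\<not> linked (F - {y}) z u"
    using z(4) by (rule obtain_separating_edge)
  have "y \<notin> X" using z(3) y(3) linked_Diff_mono[of F X z u "{y}"] by blast
  have "transversal V (F - insert y X) (insert z I)"
    using I z(1,3) y(3) by (rule transversal_Diff_insert)
  then have "insert y X \<in> tree_indep V \<I> F"
    using I\<^sub>0(1) y(2) z(2) tree_indep_iff by blast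
  then show ?thesis using y(1) \<open>y \<notin> X\<close> by blast
qed

sublocale edge_matroid: matroid F "tree_indep V \<I> F"
proof
  show "finite F" by (rule finite_edges)
  show "X \<subseteq> F" if "X \<in> tree_indep V \<I> F" for X
    using that by (simp add: tree_indep_iff)
qed (use empty_tree_indep tree_indep_hereditary tree_indep_augment in blast)+

lemma separating_set_of_basis:
  assumes "basis \<I> B" "X \<in> separating_sets B"
  shows "X \<in> tree_indep V \<I> F" "card X = matroid_rank \<I> - 1"
  using assms card_transversal_Diff[of X B]
  by (auto simp: tree_indep_iff basis_iff_card_eq_rank separating_sets_def)

lemma rank_tree_indep: "matroid_rank (tree_indep V \<I> F) = matroid_rank \<I> - 1"
proof (rule antisym)
  obtain X where X: "X \<in> tree_indep V \<I> F" "card X = matroid_rank (tree_indep V \<I> F)"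
    using edge_matroid.ex_indep_card_eq_rank by blast
  obtain I where "I \<in> \<I>" "card I = Suc (card X)" using X(1) by (rule tree_indepE)
  then show "matroid_rank (tree_indep V \<I> F) \<le> matroid_rank \<I> - 1"
    using card_indep_le_rank[of I] X(2) by simp
next
  obtain B where B: "basis \<I> B"
    using ex_indep_card_eq_rank basis_iff_card_eq_rank by blast
  then have "B \<subseteq> V" "B \<noteq> {}"
    using indep_subset rank_pos by (auto simp: basis_iff_card_eq_rank)
  then obtain X where "X \<in> separating_sets B"
    using separating_sets_nonempty by blast
  then show "matroid_rank \<I> - 1 \<le> matroid_rank (tree_indep V \<I> F)"
    using separating_set_of_basis[OF B] edge_matroid.card_indep_le_rank by metis
qed

lemma gh_run_min_weight:
  assumes "(gh_step V \<I> F w)\<^sup>*\<^sup>* {} C"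
  shows "min_weight (tree_indep V \<I> F) w C"
proof (rule edge_matroid.greedy_run_min_weight)
  have "gh_step V \<I> F w D D' \<Longrightarrow> greedy_step F (tree_indep V \<I> F) w D D'" for D D'
    by (simp add: gh_step_def greedy_step_def)
  then show "(greedy_step F (tree_indep V \<I> F) w)\<^sup>*\<^sup>* {} C"
    using assms mono_rtranclp by metis
qed

lemma gh_run_card:
  assumes "(gh_step V \<I> F w)\<^sup>*\<^sup>* {} C" "\<not> (\<exists>C'. gh_step V \<I> F w C C')"
  shows "card C = matroid_rank \<I> - 1"
proof (rule ccontr)
  assume "card C \<noteq> matroid_rank \<I> - 1"
  moreover have C: "C \<in> tree_indep V \<I> F"
    using gh_run_min_weight[OF assms(1)] by (simp add: min_weight_def)
  ultimately have less: "card C < matroid_rank \<I> - 1"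
    using edge_matroid.card_indep_le_rank[OF C] by (simp add: rank_tree_indep)
  then obtain C' where "greedy_step F (tree_indep V \<I> F) w C C'"
    using edge_matroid.ex_greedy_step[OF C] rank_tree_indep by metis
  then have "gh_step V \<I> F w C C'"
    using less by (simp add: gh_step_def greedy_step_def)
  then show False using assms(2) by blast
qed

lemma feasible_components:
  assumes "C \<in> tree_indep V \<I> F" "card C = matroid_rank \<I> - 1"
  shows "feasible V \<I> (components V (F - C))"
proof -
  obtain I where I: "C \<subseteq> F" "I \<in> \<I>" "transversal V (F - C) I" "card I = Suc (card C)"
    using assms(1) by (rule tree_indepE)
  have "basis \<I> I" using I(2,4) assms(2) rank_pos by (simp add: basis_iff_card_eq_rank)
  moreover have "card (components V (F - C)) = matroid_rank \<I>"
    using card_components_Diff[OF I(1)] assms(2) rank_pos by simp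
  ultimately show ?thesis
    unfolding feasible_def
    using partition_on_components transversal_Int_component[OF I(3)] by blast
qed

end

section \<open>Coverage and cut costs of partitions\<close>

definition crossing :: "'a set set \<Rightarrow> 'a set set \<Rightarrow> 'a set set" where
  "crossing E P = {e \<in> E. \<not> (\<exists>X\<in>P. e \<subseteq> X)}"

lemma card_Int_doubleton_eq_1_iff:
  "u \<noteq> v \<Longrightarrow> card ({u, v} \<inter> S) = 1 \<longleftrightarrow> (u \<in> S) \<noteq> (v \<in> S)"
  by (cases "u \<in> S"; cases "v \<in> S") auto

lemma
  assumes "graph V E" "partition_on V P" "e \<in> E"
  shows card_parts_meeting_edge:
      "card {X \<in> P. e \<inter> X \<noteq> {}} = (if e \<in> crossing E P then 2 else 1)"
    and card_parts_cutting_edge: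
      "card {X \<in> P. card (e \<inter> X) = 1} = (if e \<in> crossing E P then 2 else 0)"
proof -
  obtain u v where e: "e = {u, v}" "u \<noteq> v" "u \<in> V" "v \<in> V"
    using assms(1,3) by (rule graph_edgeE)
  obtain X Y where XY: "X \<in> P" "u \<in> X" "Y \<in> P" "v \<in> Y"
    using e(3,4) partition_onD1[OF assms(2)] by blast
  have part_iff: "u \<in> Z \<longleftrightarrow> Z = X" "v \<in> Z \<longleftrightarrow> Z = Y" if "Z \<in> P" for Z
    using partition_onD2[OF assms(2)] that XY by (auto simp: disjoint_def)
  have crossing_iff: "e \<in> crossing E P \<longleftrightarrow> X \<noteq> Y"
    using assms(3) XY part_iff e(1) by (auto simp: crossing_def)
  have "{Z \<in> P. e \<inter> Z \<noteq> {}} = {X, Y}"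
    using e(1) XY part_iff by auto
  then show "card {X \<in> P. e \<inter> X \<noteq> {}} = (if e \<in> crossing E P then 2 else 1)"
    using crossing_iff by simp
  have "{Z \<in> P. card (e \<inter> Z) = 1} = (if X = Y then {} else {X, Y})"
    unfolding e(1) card_Int_doubleton_eq_1_iff[OF e(2)] using XY(1,3) part_iff by auto
  then show "card {X \<in> P. card (e \<inter> X) = 1} = (if e \<in> crossing E P then 2 else 0)"
    using crossing_iff by simp
qed

lemma sum_crossing:
  fixes w :: "'a set \<Rightarrow> 'b::comm_monoid_add"
  assumes "finite E"
  shows "sum w (crossing E P) = (\<Sum>e\<in>E. if e \<in> crossing E P then w e else 0)"
proof -
  have "crossing E P = {e \<in> E. e \<in> crossing E P}" by (auto simp: crossing_def)
  then show ?thesis using sum.inter_filter[OF assms, of w "\<lambda>e. e \<in> crossing E P"] by simp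
qed

lemma partition_cost_coverage:
  assumes "graph V E" "partition_on V P"
  shows "partition_cost (coverage E w) P = sum w E + sum w (crossing E P)"
proof -
  have fin: "finite P" "finite E"
    using assms graph_finite_edges finite_elements by (auto simp: graph_def)
  have "partition_cost (coverage E w) P = (\<Sum>e\<in>E. \<Sum>X | X \<in> P \<and> e \<inter> X \<noteq> {}. w e)"
    unfolding partition_cost_def coverage_def by (rule sum.swap_restrict[OF fin])
  also have "\<dots> = (\<Sum>e\<in>E. w e + (if e \<in> crossing E P then w e else 0))"
    using card_parts_meeting_edge[OF assms] by (intro sum.cong) simp_all
  also have "\<dots> = sum w E + sum w (crossing E P)"
    by (simp add: sum.distrib sum_crossing[OF fin(2)])
  finally show ?thesis .
qed

lemma partition_cost_cut_fun:
  assumes "graph V E" "partition_on V P"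
  shows "partition_cost (cut_fun E w) P = 2 * sum w (crossing E P)"
proof -
  have fin: "finite P" "finite E"
    using assms graph_finite_edges finite_elements by (auto simp: graph_def)
  have "partition_cost (cut_fun E w) P = (\<Sum>e\<in>E. \<Sum>X | X \<in> P \<and> card (e \<inter> X) = 1. w e)"
    unfolding partition_cost_def cut_fun_def by (rule sum.swap_restrict[OF fin])
  also have "\<dots> = (\<Sum>e\<in>E. 2 * (if e \<in> crossing E P then w e else 0))"
    using card_parts_cutting_edge[OF assms] by (intro sum.cong) simp_all
  also have "\<dots> = 2 * sum w (crossing E P)"
    by (simp add: sum_distrib_left sum_crossing[OF fin(2)])
  finally show ?thesis .
qed

lemma sum_le_partition_cost:
  fixes a :: "'b \<Rightarrow> real"
  assumes "finite V" and Q: "partition_on V Q" "\<And>X. X \<in> Q \<Longrightarrow> g X \<ge> 0"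
    and B: "B \<subseteq> V" "\<And>X. X \<in> Q \<Longrightarrow> card (B \<inter> X) = 1"
    and \<beta>: "inj_on \<beta> Y" "\<And>y. y \<in> Y \<Longrightarrow> \<beta> y \<in> B"
    and charge: "\<And>y X. y \<in> Y \<Longrightarrow> X \<in> Q \<Longrightarrow> \<beta> y \<in> X \<Longrightarrow> a y \<le> g X"
  shows "sum a Y \<le> partition_cost g Q"
proof -
  have "\<exists>X\<in>Q. \<beta> y \<in> X" if "y \<in> Y" for y
    using \<beta>(2)[OF that] B(1) partition_onD1[OF Q(1)] by blast
  then obtain part where part: "\<And>y. y \<in> Y \<Longrightarrow> part y \<in> Q" "\<And>y. y \<in> Y \<Longrightarrow> \<beta> y \<in> part y"
    by metis
  have inj: "inj_on part Y"
  proof (rule inj_onI)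
    fix y y' assume y: "y \<in> Y" and y': "y' \<in> Y" and eq: "part y = part y'"
    obtain b where "B \<inter> part y = {b}"
      using B(2)[OF part(1)[OF y]] by (rule card_1_singletonE)
    then have "\<beta> y = \<beta> y'"
      using \<beta>(2) part(2) y y' eq by (metis IntI singletonD)
    then show "y = y'" using \<beta>(1) y y' by (simp add: inj_on_eq_iff)
  qed
  have "sum a Y \<le> (\<Sum>y\<in>Y. g (part y))"
    using charge part by (intro sum_mono) blast
  also have "\<dots> = sum g (part ` Y)" using sum.reindex[OF inj, of g] by simp
  also have "\<dots> \<le> partition_cost g Q"
    unfolding partition_cost_def
    using finite_elements[OF assms(1) Q(1)] part(1) Q(2) by (intro sum_mono2) auto
  finally show ?thesis .
qed

lemma cut_fun_nonneg: "\<forall>e\<in>E. w e \<ge> 0 \<Longrightarrow> cut_fun E w S \<ge> 0"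
  by (auto simp: cut_fun_def intro: sum_nonneg)

lemma sum_le_sum_cut_fun:
  assumes fin: "finite E" "finite C" and w: "\<forall>e\<in>E. w e \<ge> 0" and D: "D \<subseteq> E"
    and cut: "\<And>f. f \<in> D \<Longrightarrow> \<exists>i\<in>C. card (f \<inter> S i) = 1"
  shows "sum w D \<le> (\<Sum>i\<in>C. cut_fun E w (S i))"
proof -
  have "sum w D \<le> (\<Sum>f\<in>D. \<Sum>i | i \<in> C \<and> card (f \<inter> S i) = 1. w f)"
  proof (rule sum_mono)
    fix f assume f: "f \<in> D"
    then obtain i where "i \<in> C" "card (f \<inter> S i) = 1" using cut by blast
    then have "(\<Sum>i\<in>{i}. w f) \<le> (\<Sum>i | i \<in> C \<and> card (f \<inter> S i) = 1. w f)"
      using fin(2) w D f by (intro sum_mono2) auto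
    then show "w f \<le> (\<Sum>i | i \<in> C \<and> card (f \<inter> S i) = 1. w f)" by simp
  qed
  also have "\<dots> \<le> (\<Sum>f\<in>E. \<Sum>i | i \<in> C \<and> card (f \<inter> S i) = 1. w f)"
    using fin(1) w D by (intro sum_mono2) (auto intro: sum_nonneg)
  also have "\<dots> = (\<Sum>i\<in>C. cut_fun E w (S i))"
    unfolding cut_fun_def by (rule sum.swap_restrict[OF fin])
  finally show ?thesis .
qed

lemma coverage_cost_le_four_thirds:
  assumes "graph V E" "\<forall>e\<in>E. w e \<ge> 0" "partition_on V P" "partition_on V Q"
    and twice: "sum w (crossing E P) \<le> 2 * sum w (crossing E Q)"
  shows "partition_cost (coverage E w) P \<le> 4 / 3 * partition_cost (coverage E w) Q"
proof -
  have "sum w (crossing E P) \<le> sum w E"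
    using graph_finite_edges[OF assms(1)] assms(2) by (intro sum_mono2) (auto simp: crossing_def)
  then show ?thesis
    using twice by (simp add: partition_cost_coverage[OF assms(1)] assms(3,4))
qed

lemma opt_attained:
  assumes "finite V" "feasible V \<I> P"
  obtains Q where "feasible V \<I> Q" "opt V \<I> f = partition_cost f Q"
proof -
  have "finite {Q. feasible V \<I> Q}"
    using finitely_many_partition_on[OF assms(1)]
    by (rule rev_finite_subset) (auto simp: feasible_def)
  then have "opt V \<I> f \<in> partition_cost f ` {Q. feasible V \<I> Q}"
    unfolding opt_def using assms(2) by (intro Min_in) auto
  then show thesis using that by blast
qed

section \<open>Gomory--Hu trees\<close>

locale gomory_hu =
  fixes V :: "'a set" and g :: "'a set \<Rightarrow> real" and F :: "'a set set" and w\<^sub>H :: "'a set \<Rightarrow> real"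
  assumes gomory_hu: "gomory_hu_tree V g F w\<^sub>H"

sublocale gomory_hu \<subseteq> tree_graph V F
  using gomory_hu by unfold_locales (simp add: gomory_hu_tree_def)

context gomory_hu
begin

lemma edge_is_arg_min:
  assumes "{s, t} \<in> F"
  shows "is_arg_min g (\<lambda>S. s \<in> S \<and> S \<subseteq> V - {t}) (component V (F - {{s, t}}) s)"
    and "w\<^sub>H {s, t} = g (component V (F - {{s, t}}) s)"
proof -
  have st: "s \<noteq> t" "s \<in> V" "t \<in> V" using edgeE[OF assms] by (metis doubleton_eq_iff)+
  let ?S = "{S. s \<in> S \<and> S \<subseteq> V - {t}}"
  have path: "is_path V F s [s, t] t" using st assms by (simp add: is_path_def)
  have "is_arg_min w\<^sub>H (\<lambda>e. e \<in> path_edges [s, t]) {s, t}" by (simp add: is_arg_min_def)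
  then show arg_min: "is_arg_min g (\<lambda>S. s \<in> S \<and> S \<subseteq> V - {t}) (component V (F - {{s, t}}) s)"
    using gomory_hu st path unfolding gomory_hu_tree_def by blast
  have "w\<^sub>H {s, t} = Min (w\<^sub>H ` path_edges [s, t])" by simp
  also have "\<dots> = Min (g ` ?S)"
    using gomory_hu st path unfolding gomory_hu_tree_def by blast
  also have "\<dots> = g (component V (F - {{s, t}}) s)"
  proof (rule Min_eqI)
    have "?S \<subseteq> Pow V" by blast
    then show "finite (g ` ?S)" using finite_vertices finite_subset by blast
  qed (use arg_min in \<open>auto simp: is_arg_min_linorder\<close>)
  finally show "w\<^sub>H {s, t} = g (component V (F - {{s, t}}) s)" .
qed

lemma edge_weight_le:
  assumes "{s, t} \<in> F" "s \<in> S" "t \<notin> S" "S \<subseteq> V"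
  shows "w\<^sub>H {s, t} \<le> g S"
  using edge_is_arg_min[OF assms(1)] assms(2-4) by (auto simp: is_arg_min_linorder)

lemma fundamental_cut_value:
  assumes "e \<in> F"
  shows "g (fundamental_cut e) = w\<^sub>H e"
proof -
  have "(SOME s. s \<in> e) \<in> e" using edgeE[OF assms] by (metis insertI1 someI)
  then obtain t where "e = {SOME s. s \<in> e, t}"
    using edgeE[OF assms] by (metis doubleton_eq_iff empty_iff insert_iff)
  then show ?thesis
    using edge_is_arg_min(2) assms unfolding fundamental_cut_def by metis
qed

lemma min_separating_set_weight_le:
  assumes Y: "is_arg_min (sum w\<^sub>H) (\<lambda>Y. Y \<in> separating_sets B) Y" and y: "y \<in> Y"
    and joined: "b \<in> B" "c \<in> B" "linked (F - (Y - {y})) b c"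
    and S: "b \<in> S" "c \<notin> S" "S \<subseteq> V"
  shows "w\<^sub>H y \<le> g S"
proof -
  have sep: "Y \<in> separating_sets B" using Y by (simp add: is_arg_min_def)
  then have "B \<subseteq> V" "Y \<subseteq> F" using transversal_subset by (auto simp: separating_sets_def)
  then have "b \<in> V" "c \<in> V" "finite Y"
    using joined(1,2) finite_edges finite_subset by blast+
  then obtain s t where st: "{s, t} \<in> F" "s \<in> S" "t \<notin> S" "\<not> linked (F - {{s, t}}) b c"
    using S(1,2) obtain_separating_crossing_edge by metis
  note exchange = separating_sets_exchange[OF sep y joined st(1,4)]
  have "w\<^sub>H y + sum w\<^sub>H (Y - {y}) = sum w\<^sub>H Y"
    using sum.remove[OF \<open>finite Y\<close> y, of w\<^sub>H] by simp
  also have "\<dots> \<le> sum w\<^sub>H (insert {s, t} (Y - {y}))"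
    using Y exchange(2) unfolding is_arg_min_linorder by blast
  also have "\<dots> = w\<^sub>H {s, t} + sum w\<^sub>H (Y - {y})" using \<open>finite Y\<close> exchange(1) by simp
  finally have "w\<^sub>H y \<le> w\<^sub>H {s, t}" by simp
  also have "\<dots> \<le> g S" using st S(3) by (intro edge_weight_le)
  finally show ?thesis .
qed

lemma ex_cheap_separating_set:
  assumes Q: "partition_on V Q" "\<And>X. X \<in> Q \<Longrightarrow> g X \<ge> 0"
    and B: "B \<subseteq> V" "B \<noteq> {}" "\<And>X. X \<in> Q \<Longrightarrow> card (B \<inter> X) = 1"
  shows "\<exists>Y\<in>separating_sets B. sum w\<^sub>H Y \<le> partition_cost g Q"
proof -
  have "finite (separating_sets B)" using finite_edges by (simp add: separating_sets_def)
  then obtain Y where Y: "is_arg_min (sum w\<^sub>H) (\<lambda>Y. Y \<in> separating_sets B) Y"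
    using ex_is_arg_min_if_finite separating_sets_nonempty[OF B(1,2)] by blast
  then have sep: "Y \<in> separating_sets B" by (simp add: is_arg_min_def)
  obtain \<beta> \<gamma> where inj: "inj_on \<beta> Y" and \<beta>: "\<And>y. y \<in> Y \<Longrightarrow> \<beta> y \<in> B" and \<gamma>: "\<And>y. y \<in> Y \<Longrightarrow> \<gamma> y \<in> B"
    and joined: "\<And>y. y \<in> Y \<Longrightarrow> linked (F - (Y - {y})) (\<beta> y) (\<gamma> y)"
    and separated: "\<And>y. y \<in> Y \<Longrightarrow> \<not> linked (F - {y}) (\<beta> y) (\<gamma> y)"
    using obtain_separated_representatives[OF sep] by metis
  have charge: "w\<^sub>H y \<le> g X" if y: "y \<in> Y" and X: "X \<in> Q" "\<beta> y \<in> X" for y X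
  proof (rule min_separating_set_weight_le[OF Y y \<beta>[OF y] \<gamma>[OF y] joined[OF y] X(2)])
    have "\<beta> y \<noteq> \<gamma> y" using separated[OF y] by force
    then show "\<gamma> y \<notin> X"
      using card_1_singletonE[OF B(3)[OF X(1)]] \<beta>[OF y] \<gamma>[OF y] X(2) by (metis IntI singletonD)
    show "X \<subseteq> V" using X(1) partition_onD1[OF Q(1)] by blast
  qed
  have "sum w\<^sub>H Y \<le> partition_cost g Q"
    using finite_vertices Q B(1,3) inj \<beta> charge by (rule sum_le_partition_cost[where g = g])
  then show ?thesis using sep by blast
qed

end

lemma crossing_components_le:
  assumes "graph V E" "\<forall>e\<in>E. w e \<ge> 0" "gomory_hu_tree V (cut_fun E w) F w\<^sub>H" "C \<subseteq> F"
  shows "sum w (crossing E (components V (F - C))) \<le> sum w\<^sub>H C"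
proof -
  interpret gomory_hu V "cut_fun E w" F w\<^sub>H using assms(3) by unfold_locales
  have "\<exists>e\<in>C. card (f \<inter> fundamental_cut e) = 1" if f: "f \<in> crossing E (components V (F - C))" for f
  proof -
    have "f \<in> E" using f by (simp add: crossing_def)
    with assms(1) obtain u v where uv: "f = {u, v}" "u \<noteq> v" "u \<in> V" "v \<in> V"
      by (rule graph_edgeE)
    have "\<not> linked (F - C) u v"
      using f uv by (auto simp: crossing_def components_def component_eq_linked)
    with uv(3,4) obtain e where e: "e \<in> C" "e \<in> F" "\<not> linked (F - {e}) u v"
      by (rule obtain_separating_edge)
    have "card (f \<inter> fundamental_cut e) = 1"
      unfolding uv(1) card_Int_doubleton_eq_1_iff[OF uv(2)]
      using e(2) uv(3,4) e(3) by (rule fundamental_cut_separates)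
    then show ?thesis using e(1) by blast
  qed
  moreover have "finite C" using assms(4) finite_edges finite_subset by blast
  ultimately have
    "sum w (crossing E (components V (F - C))) \<le> (\<Sum>e\<in>C. cut_fun E w (fundamental_cut e))"
    using graph_finite_edges[OF assms(1)] assms(2)
    by (intro sum_le_sum_cut_fun) (auto simp: crossing_def)
  also have "\<dots> = sum w\<^sub>H C"
    using assms(4) fundamental_cut_value by (intro sum.cong) auto
  finally show ?thesis .
qed

lemma ex_cheap_tree_indep:
  assumes "gomory_hu_tree V g F w\<^sub>H" "matroid V \<I>" "matroid_rank \<I> \<ge> 1"
    and Q: "feasible V \<I> Q" "\<And>X. X \<in> Q \<Longrightarrow> g X \<ge> 0"
  shows "\<exists>Y\<in>tree_indep V \<I> F. card Y = matroid_rank \<I> - 1 \<and> sum w\<^sub>H Y \<le> partition_cost g Q"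
proof -
  interpret gomory_hu V g F w\<^sub>H using assms(1) by unfold_locales
  interpret matroid V \<I> by (rule assms(2))
  interpret tree_matroid V F \<I> using assms(3) by unfold_locales
  obtain B where B: "basis \<I> B" "\<And>X. X \<in> Q \<Longrightarrow> card (B \<inter> X) = 1" and part: "partition_on V Q"
    using Q(1) by (auto simp: feasible_def)
  have "B \<subseteq> V" "B \<noteq> {}"
    using B(1) indep_subset rank_pos by (auto simp: basis_iff_card_eq_rank)
  then obtain Y where "Y \<in> separating_sets B" "sum w\<^sub>H Y \<le> partition_cost g Q"
    using ex_cheap_separating_set[OF part Q(2) _ _ B(2)] by blast
  then show ?thesis using separating_set_of_basis[OF B(1)] by blast
qed

lemma gh_algorithm_returnsE:
  assumes "gh_algorithm_returns V g \<I> P" "matroid V \<I>" "matroid_rank \<I> \<ge> 1"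
  obtains F w\<^sub>H C where "gomory_hu_tree V g F w\<^sub>H" "min_weight (tree_indep V \<I> F) w\<^sub>H C"
    "card C = matroid_rank \<I> - 1" "P = components V (F - C)" "feasible V \<I> P"
proof -
  obtain F w\<^sub>H C where gh: "gomory_hu_tree V g F w\<^sub>H"
    and run: "(gh_step V \<I> F w\<^sub>H)\<^sup>*\<^sup>* {} C" "\<not> (\<exists>C'. gh_step V \<I> F w\<^sub>H C C')"
    and P: "P = components V (F - C)"
    using assms(1) by (auto simp: gh_algorithm_returns_def)
  interpret gomory_hu V g F w\<^sub>H using gh by unfold_locales
  interpret matroid V \<I> by (rule assms(2))
  interpret tree_matroid V F \<I> using assms(3) by unfold_locales
  have "min_weight (tree_indep V \<I> F) w\<^sub>H C" using run(1) by (rule gh_run_min_weight)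
  moreover have "card C = matroid_rank \<I> - 1" using run by (rule gh_run_card)
  moreover from calculation have "feasible V \<I> P"
    unfolding P by (intro feasible_components) (simp_all add: min_weight_def)
  ultimately show thesis using that gh P by blast
qed

theorem theorem5:
  fixes V :: "'a set" and E :: "'a set set" and w :: "'a set \<Rightarrow> real"
    and \<I> :: "'a set set" and k :: nat and P :: "'a set set"
  assumes "graph V E"
    and "\<forall>e\<in>E. w e \<ge> 0"
    and "matroid V \<I>"
    and "matroid_rank \<I> = k"
    and "k \<ge> 1"
    and "gh_algorithm_returns V (cut_fun E w) \<I> P"
  shows "feasible V \<I> P \<and>
    partition_cost (coverage E w) P \<le> 4 / 3 * opt V \<I> (coverage E w)"
proof -
  have rank: "matroid_rank \<I> \<ge> 1" using assms(4,5) by simp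
  obtain F w\<^sub>H C where gh: "gomory_hu_tree V (cut_fun E w) F w\<^sub>H"
    and C: "min_weight (tree_indep V \<I> F) w\<^sub>H C" "card C = matroid_rank \<I> - 1"
    and P: "P = components V (F - C)" "feasible V \<I> P"
    using assms(6,3) rank by (rule gh_algorithm_returnsE)
  obtain Q where Q: "feasible V \<I> Q" "opt V \<I> (coverage E w) = partition_cost (coverage E w) Q"
    using matroid.finite_ground[OF assms(3)] P(2) by (rule opt_attained)
  obtain Y where Y: "Y \<in> tree_indep V \<I> F" "card Y = matroid_rank \<I> - 1"
    "sum w\<^sub>H Y \<le> partition_cost (cut_fun E w) Q"
    using ex_cheap_tree_indep[OF gh assms(3) rank Q(1) cut_fun_nonneg[OF assms(2)]] by blast
  have "C \<subseteq> F" using C(1) by (simp add: min_weight_def tree_indep_def)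
  then have "sum w (crossing E P) \<le> sum w\<^sub>H C"
    unfolding P(1) by (rule crossing_components_le[OF assms(1,2) gh])
  also have "\<dots> \<le> sum w\<^sub>H Y" using C Y(1,2) by (simp add: min_weight_def)
  also have "\<dots> \<le> 2 * sum w (crossing E Q)"
    using Y(3) Q(1) partition_cost_cut_fun[OF assms(1)] by (simp add: feasible_def)
  finally show ?thesis
    using coverage_cost_le_four_thirds[OF assms(1,2)] P(2) Q by (simp add: feasible_def)
qed

end
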